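(* Let $1<p<\infty$, and let $r_1,r_2\ge 0$ and $s_1,s_2>0$ be real numbers. Let $T_0:\ell_p\to\ell_p$ be the bounded linear operator given, for $x=\{x_n\}_{n\ge1}$ (with $x_{-1}=x_0=0$), by $(T_0x)_n=s_1x_{n-2}+r_1x_n+s_1x_{n+2}$ if $n$ is odd and $(T_0x)_n=s_2x_{n-2}+r_2x_n+s_2x_{n+2}$ if $n$ is even. Then the spectrum of $T_0$ over $\ell_p$ is $$\sigma(T_0,\ell_p)=[r_1-2s_1,r_1+2s_1]\cup[r_2-2s_2,r_2+2s_2].$$
   Context: $\ell_p$ is the complex Banach space of $p$-summable sequences $x=\{x_n\}_{n\ge 1}$. $\sigma(A,X)$ is the set of $\lambda\in\mathbb{C}$ such that $A-\lambda I$ has no bounded inverse on $X$. Intervals $[a,b]$ are closed intervals of the real line, viewed as subsets of $\mathbb{C}$. *)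

theory Defs
  imports "HOL-Analysis.Analysis"
begin

text \<open>
  A sequence $(x_n)_{n \geq 1}$ is represented by a function on the natural numbers whose value
  at the spurious index 0 is 0. The exponent is a real parameter, so the spaces are carrier sets
  of functions and not types; the series below start at index 0, but that term vanishes.
\<close>

definition lp :: "real \<Rightarrow> (nat \<Rightarrow> complex) set" where
  "lp p = {x. x 0 = 0 \<and> summable (\<lambda>n. cmod (x n) powr p)}"

definition lp_norm :: "real \<Rightarrow> (nat \<Rightarrow> complex) \<Rightarrow> real" where
  "lp_norm p x = (\<Sum>n. cmod (x n) powr p) powr (1 / p)"

definition lp_bounded_linear ::
    "real \<Rightarrow> ((nat \<Rightarrow> complex) \<Rightarrow> (nat \<Rightarrow> complex)) \<Rightarrow> bool" where
  "lp_bounded_linear p A \<longleftrightarrow>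
     (\<forall>x\<in>lp p. A x \<in> lp p) \<and>
     (\<forall>x\<in>lp p. \<forall>y\<in>lp p. A (\<lambda>n. x n + y n) = (\<lambda>n. A x n + A y n)) \<and>
     (\<forall>c. \<forall>x\<in>lp p. A (\<lambda>n. c * x n) = (\<lambda>n. c * A x n)) \<and>
     (\<exists>C. \<forall>x\<in>lp p. lp_norm p (A x) \<le> C * lp_norm p x)"

definition lp_spectrum ::
    "real \<Rightarrow> ((nat \<Rightarrow> complex) \<Rightarrow> (nat \<Rightarrow> complex)) \<Rightarrow> complex set" where
  "lp_spectrum p A =
     {z. \<not> (\<exists>B. lp_bounded_linear p B \<and>
              (\<forall>x\<in>lp p. B (\<lambda>n. A x n - z * x n) = x) \<and>
              (\<forall>y\<in>lp p. (\<lambda>n. A (B y) n - z * B y n) = y))}"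

text \<open>
  Natural number subtraction is truncated, so for \<open>n = 1\<close> and \<open>n = 2\<close> the entry
  \<open>x (n - 2)\<close> is \<open>x 0\<close>, which is 0 on the carrier; this is the convention $x_{-1} = x_0 = 0$.
\<close>

definition T0 ::
    "real \<Rightarrow> real \<Rightarrow> real \<Rightarrow> real \<Rightarrow> (nat \<Rightarrow> complex) \<Rightarrow> (nat \<Rightarrow> complex)" where
  "T0 r1 r2 s1 s2 x = (\<lambda>n.
     if n = 0 then 0
     else if odd n then of_real s1 * x (n - 2) + of_real r1 * x n + of_real s1 * x (n + 2)
     else of_real s2 * x (n - 2) + of_real r2 * x n + of_real s2 * x (n + 2))"

lemma powr_sum3_le:
  fixes a b c p :: real
  assumes "a \<ge> 0" "b \<ge> 0" "c \<ge> 0" "p > 0"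
  shows "(a + b + c) powr p \<le> 3 powr p * (a powr p + b powr p + c powr p)"
proof -
  define m where "m = max a (max b c)"
  have "(a + b + c) powr p \<le> (3 * m) powr p"
    using assms by (intro powr_mono2) (auto simp: m_def)
  also have "\<dots> = 3 powr p * m powr p"
    using assms by (simp add: powr_mult m_def)
  also have "m powr p \<le> a powr p + b powr p + c powr p"
    using assms by (simp add: m_def max_def)
  finally show ?thesis by simp
qed

lemma T0_bounded_linear:
  assumes "p > 1"
  shows "lp_bounded_linear p (T0 r1 r2 s1 s2)"
proof -
  define M where "M = max (max \<bar>r1\<bar> \<bar>r2\<bar>) (max \<bar>s1\<bar> \<bar>s2\<bar>)"
  define K where "K = (M * 3) powr p"
  have M: "M \<ge> 0" by (simp add: M_def)
  have b: "\<bar>r1\<bar> \<le> M" "\<bar>r2\<bar> \<le> M" "\<bar>s1\<bar> \<le> M" "\<bar>s2\<bar> \<le> M"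
    unfolding M_def by linarith+
  have main: "T0 r1 r2 s1 s2 x \<in> lp p \<and>
      lp_norm p (T0 r1 r2 s1 s2 x) \<le> (3 * K) powr (1 / p) * lp_norm p x"
    if x: "x \<in> lp p" for x
  proof -
    define f where "f = (\<lambda>n. cmod (x n) powr p)"
    define y where "y = T0 r1 r2 s1 s2 x"
    have f: "summable f" "f 0 = 0" "\<And>n. f n \<ge> 0"
      using x by (auto simp: f_def lp_def)
    have tri: "cmod (of_real s * a + of_real r * b + of_real s * c)
        \<le> M * (cmod a + cmod b + cmod c)" if "\<bar>s\<bar> \<le> M" "\<bar>r\<bar> \<le> M" for s r a b c
    proof -
      have "cmod (of_real s * a + of_real r * b + of_real s * c)
          \<le> \<bar>s\<bar> * cmod a + \<bar>r\<bar> * cmod b + \<bar>s\<bar> * cmod c"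
        by (intro order_trans[OF norm_triangle_ineq] add_mono) (auto simp: norm_mult)
      also have "\<dots> \<le> M * cmod a + M * cmod b + M * cmod c"
        using that by (intro add_mono mult_right_mono) auto
      finally show ?thesis by (simp add: algebra_simps)
    qed
    have le: "cmod (y n) powr p \<le> K * (f (n - 2) + f n + f (n + 2))" for n
    proof -
      have "cmod (y n) \<le> M * (cmod (x (n - 2)) + cmod (x n) + cmod (x (n + 2)))"
      proof (cases "n = 0")
        case True
        thus ?thesis using M by (simp add: y_def T0_def)
      next
        case False
        thus ?thesis using tri[OF b(3,1)] tri[OF b(4,2)] by (simp add: y_def T0_def)
      qed
      hence "cmod (y n) powr p \<le> (M * (cmod (x (n - 2)) + cmod (x n) + cmod (x (n + 2)))) powr p"
        using assms by (intro powr_mono2) auto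
      also have "\<dots> = M powr p * (cmod (x (n - 2)) + cmod (x n) + cmod (x (n + 2))) powr p"
        using M by (simp add: powr_mult)
      also have "\<dots> \<le> M powr p * (3 powr p * (f (n - 2) + f n + f (n + 2)))"
        unfolding f_def using assms by (intro mult_left_mono powr_sum3_le) auto
      finally show ?thesis using M by (simp add: K_def powr_mult mult.assoc)
    qed
    have sh1: "summable (\<lambda>n. f (n - 2))"
      using summable_iff_shift[of "\<lambda>n. f (n - 2)" 2] f(1) by simp
    have e1: "(\<Sum>n. f (n - 2)) = suminf f"
      using suminf_split_initial_segment[OF sh1, of 2] f(2) by (simp add: numeral_2_eq_2)
    have sh2: "summable (\<lambda>n. f (n + 2))"
      using summable_iff_shift[of f 2] f(1) by simp
    have e2: "(\<Sum>n. f (n + 2)) \<le> suminf f"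
      using suminf_split_initial_segment[OF f(1), of 2] sum_nonneg[of "{..<2}" f] f(3) by simp
    have S: "summable (\<lambda>n. K * (f (n - 2) + f n + f (n + 2)))"
      by (intro summable_mult summable_add sh1 sh2 f)
    have Y: "summable (\<lambda>n. cmod (y n) powr p)"
      using le by (intro summable_comparison_test'[OF S, of 0]) auto
    have "(\<Sum>n. cmod (y n) powr p) \<le> (\<Sum>n. K * (f (n - 2) + f n + f (n + 2)))"
      by (intro suminf_le le Y S)
    also have "\<dots> = K * ((\<Sum>n. f (n - 2)) + suminf f + (\<Sum>n. f (n + 2)))"
      by (simp add: suminf_mult suminf_add[symmetric] summable_add sh1 sh2[simplified] f)
    also have "\<dots> \<le> K * (3 * suminf f)"
      using e1 e2 by (intro mult_left_mono) (auto simp: K_def)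
    finally have "lp_norm p y \<le> (3 * K * suminf f) powr (1 / p)"
      unfolding lp_norm_def using assms
      by (intro powr_mono2) (auto simp: mult_ac intro: suminf_nonneg Y)
    also have "\<dots> = (3 * K) powr (1 / p) * lp_norm p x"
      unfolding lp_norm_def f_def[symmetric]
      by (intro powr_mult)
    finally show ?thesis
      using Y by (auto simp: y_def lp_def T0_def)
  qed
  show ?thesis
    unfolding lp_bounded_linear_def
  proof (intro conjI)
    show "\<exists>C. \<forall>x\<in>lp p. lp_norm p (T0 r1 r2 s1 s2 x) \<le> C * lp_norm p x"
      using main by blast
  qed (use main in \<open>auto simp: T0_def fun_eq_iff algebra_simps\<close>)
qed

end

theory Submission
  imports Defs
begin

text \<open>
  The operator acts separately on the odd and on the even coordinates, and with \<open>S\<close> the right shift on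
  such a subsequence it is \<open>s (S + S\<^sup>* ) + r\<close>. If \<open>(z - r) / s\<close> is not in \<open>[-2, 2]\<close>, it equals
  \<open>w + 1 / w\<close> for some \<open>\<bar>w\<bar> < 1\<close>, and since \<open>S\<^sup>* S = 1\<close> we get the factorisation
  \<open>T - z = -(s / w) (1 - w S\<^sup>* ) (1 - w S)\<close>, whose factors are inverted by geometric series.
  If \<open>(z - r) / s = 2 c\<close> with \<open>\<bar>c\<bar> \<le> 1\<close>, the first unit vector of that subsequence is not in the
  range: a preimage \<open>a\<close> would satisfy \<open>a\<^sub>k\<^sub>+\<^sub>2 = 2 c a\<^sub>k\<^sub>+\<^sub>1 - a\<^sub>k\<close>, which preserves the semidefinite form
  \<open>a\<^sub>k\<^sub>+\<^sub>1\<^sup>2 + a\<^sub>k\<^sup>2 - 2 c a\<^sub>k a\<^sub>k\<^sub>+\<^sub>1\<close>, and \<open>a\<^sub>k \<longlonglongrightarrow> 0\<close> then forces \<open>a = 0\<close>.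
\<close>

section \<open>Bounded operators on sequence spaces\<close>

lemma lp_tendsto_0:
  assumes "p > 0" "x \<in> lp p"
  shows "x \<longlonglongrightarrow> 0"
proof -
  have "(\<lambda>n. cmod (x n) powr p) \<longlonglongrightarrow> 0"
    using assms by (auto simp: lp_def intro: summable_LIMSEQ_zero)
  hence "(\<lambda>n. (cmod (x n) powr p) powr (1 / p)) \<longlonglongrightarrow> 0 powr (1 / p)"
    using assms by (intro tendsto_powr') auto
  hence "(\<lambda>n. cmod (x n)) \<longlonglongrightarrow> 0"
    using assms by (simp add: powr_powr)
  thus ?thesis by (rule tendsto_norm_zero_cancel)
qed

lemma lp_bounded:
  assumes "p > 0" "x \<in> lp p"
  shows "\<exists>M. \<forall>n. cmod (x n) \<le> M"
proof -
  have "Bseq x"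
    using lp_tendsto_0[OF assms] by (intro convergent_imp_Bseq) (auto simp: convergent_def)
  thus ?thesis by (auto simp: Bseq_def)
qed

lemma lp_norm_nonneg: "lp_norm p x \<ge> 0"
  by (simp add: lp_norm_def)

text \<open>Domination of the partial sums yields membership and the norm bound at once. The
  constant refers to \<open>p\<close>-th powers, hence the root
  \<open>K powr (1 / p)\<close>.\<close>

lemma lp_dominated:
  assumes p: "p > 0" and K: "K \<ge> 0" and y0: "y 0 = 0"
    and le: "\<And>N. (\<Sum>n<N. cmod (y n) powr p) \<le> K * (\<Sum>n. cmod (x n) powr p)"
  shows "y \<in> lp p" "lp_norm p y \<le> K powr (1 / p) * lp_norm p x"
proof -
  have sm: "summable (\<lambda>n. cmod (y n) powr p)"
    by (rule summableI_nonneg_bounded[OF _ le]) auto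
  thus "y \<in> lp p" using y0 by (simp add: lp_def)
  have "(\<Sum>n. cmod (y n) powr p) \<le> K * (\<Sum>n. cmod (x n) powr p)"
    by (rule suminf_le_const[OF sm le])
  hence "lp_norm p y \<le> (K * (\<Sum>n. cmod (x n) powr p)) powr (1 / p)"
    unfolding lp_norm_def using p by (intro powr_mono2) (auto intro: suminf_nonneg sm)
  thus "lp_norm p y \<le> K powr (1 / p) * lp_norm p x"
    by (simp add: lp_norm_def powr_mult)
qed

lemma lp_bounded_linear_compose:
  assumes A: "lp_bounded_linear p A" and B: "lp_bounded_linear p B"
  shows "lp_bounded_linear p (\<lambda>x. A (B x))"
proof -
  obtain C where C: "\<forall>x\<in>lp p. lp_norm p (A x) \<le> C * lp_norm p x"
    using A unfolding lp_bounded_linear_def by auto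
  obtain D where D: "\<forall>x\<in>lp p. lp_norm p (B x) \<le> D * lp_norm p x"
    using B unfolding lp_bounded_linear_def by auto
  have B': "x \<in> lp p \<Longrightarrow> B x \<in> lp p" for x
    using B by (simp add: lp_bounded_linear_def)
  have "lp_norm p (A (B x)) \<le> (\<bar>C\<bar> * D) * lp_norm p x" if "x \<in> lp p" for x
  proof -
    have "lp_norm p (A (B x)) \<le> C * lp_norm p (B x)"
      using C B' that by simp
    also have "\<dots> \<le> \<bar>C\<bar> * lp_norm p (B x)"
      by (intro mult_right_mono lp_norm_nonneg) auto
    also have "\<dots> \<le> \<bar>C\<bar> * (D * lp_norm p x)"
      using D that by (intro mult_left_mono) auto
    finally show ?thesis by simp
  qed
  thus ?thesis
    using A B B' unfolding lp_bounded_linear_def by (auto intro!: exI[of _ "\<bar>C\<bar> * D"])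
qed

lemma lp_bounded_linear_diag:
  assumes p: "p > 0" and c: "\<And>n. cmod (c n) \<le> K"
  shows "lp_bounded_linear p (\<lambda>x n. c n * x n)"
proof -
  have K: "K \<ge> 0" using c[of 0] norm_ge_zero order_trans by blast
  have main: "(\<lambda>n. c n * x n) \<in> lp p \<and>
      lp_norm p (\<lambda>n. c n * x n) \<le> (K powr p) powr (1 / p) * lp_norm p x" if x: "x \<in> lp p" for x
  proof -
    have sm: "summable (\<lambda>n. cmod (x n) powr p)" using x by (simp add: lp_def)
    have "(\<Sum>n<N. cmod (c n * x n) powr p) \<le> K powr p * (\<Sum>n. cmod (x n) powr p)" for N
    proof -
      have "(\<Sum>n<N. cmod (c n * x n) powr p) \<le> (\<Sum>n<N. K powr p * cmod (x n) powr p)"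
        using c p by (intro sum_mono) (auto simp: norm_mult powr_mult intro!: mult_right_mono powr_mono2)
      also have "\<dots> \<le> K powr p * (\<Sum>n. cmod (x n) powr p)"
        unfolding sum_distrib_left[symmetric] by (intro mult_left_mono sum_le_suminf sm) auto
      finally show ?thesis .
    qed
    thus ?thesis
      using lp_dominated[of p "K powr p" "\<lambda>n. c n * x n" x] p x by (auto simp: lp_def)
  qed
  show ?thesis
    unfolding lp_bounded_linear_def
  proof (intro conjI)
    show "\<exists>C. \<forall>x\<in>lp p. lp_norm p (\<lambda>n. c n * x n) \<le> C * lp_norm p x" using main by blast
  qed (use main in \<open>auto simp: algebra_simps\<close>)
qed

text \<open>With \<open>g n k = n + 2 * k\<close> this is the Neumann series of
  \<open>1 - w S\<^sup>*\<close>, with the truncated \<open>n - 2 * k\<close> that of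
  \<open>1 - w S\<close>. The ratio depends on \<open>n\<close> so that both parity classes are
  treated at once.\<close>

definition geom_op ::
    "(nat \<Rightarrow> complex) \<Rightarrow> (nat \<Rightarrow> nat \<Rightarrow> nat) \<Rightarrow> (nat \<Rightarrow> complex) \<Rightarrow> nat \<Rightarrow> complex" where
  "geom_op w g x = (\<lambda>n. if n = 0 then 0 else \<Sum>k. w n ^ k * x (g n k))"

lemma summable_geom_op:
  fixes w :: complex
  assumes "cmod w < 1" "\<And>k. cmod (a k) \<le> M"
  shows "summable (\<lambda>k. w ^ k * a k)"
proof (rule summable_comparison_test')
  show "summable (\<lambda>k. cmod w ^ k * M)"
    using assms by (intro summable_mult2 summable_geometric) auto
  show "cmod (w ^ k * a k) \<le> cmod w ^ k * M" for k
    using assms by (simp add: norm_mult norm_power mult_left_mono)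
qed

text \<open>
  Splitting \<open>q = t\<^sup>2\<close> replaces Hoelder's inequality: one factor \<open>t\<^sup>k\<close> is summed, and the supremum of
  the remaining \<open>t\<^sup>k \<bar>a k\<bar>\<close> is at most their \<open>\<ell>\<^sub>p\<close> norm.
\<close>

lemma geometric_series_powr_le:
  fixes w :: complex
  assumes p: "p > 0" and t: "0 \<le> t" "t < 1" and w: "cmod w \<le> t\<^sup>2"
    and a: "\<And>k. cmod (a k) powr p \<le> F"
  shows "cmod (\<Sum>k. w ^ k * a k) powr p
    \<le> (1 / (1 - t)) powr p * (\<Sum>k. (t powr p) ^ k * cmod (a k) powr p)"
    and "summable (\<lambda>k. (t powr p) ^ k * cmod (a k) powr p)"
proof -
  define D where "D = (\<Sum>k. (t powr p) ^ k * cmod (a k) powr p)"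
  have tp: "t powr p < 1"
    using powr_less_mono2[of p t 1] t p by simp
  show sm: "summable (\<lambda>k. (t powr p) ^ k * cmod (a k) powr p)"
  proof (rule summable_comparison_test')
    show "summable (\<lambda>k. (t powr p) ^ k * F)"
      using tp by (intro summable_mult2 summable_geometric) auto
  qed (use a in \<open>auto intro!: mult_left_mono\<close>)
  have D0: "D \<ge> 0" unfolding D_def by (intro suminf_nonneg sm) auto
  have ub: "t ^ k * cmod (a k) \<le> D powr (1 / p)" for k
  proof -
    \<comment> \<open>The case \<open>t = 0\<close> is split off because rewriting
      \<open>t ^ k\<close> as a real power needs \<open>t > 0\<close>.\<close>
    have "(t ^ k * cmod (a k)) powr p = (t powr p) ^ k * cmod (a k) powr p"
      using t by (cases "k = 0"; cases "t = 0")
        (auto simp: powr_mult powr_realpow[symmetric] powr_powr mult.commute zero_power)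
    also have "\<dots> \<le> D"
      unfolding D_def using sum_le_suminf[OF sm, of "{k}"] by auto
    finally have "((t ^ k * cmod (a k)) powr p) powr (1 / p) \<le> D powr (1 / p)"
      using p by (intro powr_mono2) auto
    thus ?thesis using p t by (simp add: powr_powr)
  qed
  have le: "cmod (w ^ k * a k) \<le> t ^ k * D powr (1 / p)" for k
  proof -
    have "cmod (w ^ k * a k) \<le> (t\<^sup>2) ^ k * cmod (a k)"
      using w by (auto simp: norm_mult norm_power intro!: mult_right_mono power_mono)
    also have "\<dots> = t ^ k * (t ^ k * cmod (a k))"
      by (simp add: power2_eq_square power_mult_distrib)
    also have "\<dots> \<le> t ^ k * D powr (1 / p)"
      using t ub by (intro mult_left_mono) auto
    finally show ?thesis .
  qed
  have gs: "(\<lambda>k. t ^ k * D powr (1 / p)) sums (1 / (1 - t) * D powr (1 / p))"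
    using t by (intro sums_mult2 geometric_sums) auto
  have "cmod (\<Sum>k. w ^ k * a k) \<le> 1 / (1 - t) * D powr (1 / p)"
    using norm_suminf_le[OF le sums_summable[OF gs]] sums_unique[OF gs] by simp
  hence "cmod (\<Sum>k. w ^ k * a k) powr p \<le> (1 / (1 - t) * D powr (1 / p)) powr p"
    using p by (intro powr_mono2) auto
  thus "cmod (\<Sum>k. w ^ k * a k) powr p \<le> (1 / (1 - t)) powr p * D"
    using p D0 unfolding powr_mult powr_powr by simp
qed

text \<open>After the pointwise estimate of the geometric series, the sums over \<open>n\<close> and
  \<open>k\<close> are interchanged, and \<open>g\<close> bounds each inner sum by the full series
  of \<open>f\<close>. The hypothesis restricts to \<open>f 0 = 0\<close> because truncated
  subtraction sends many indices to 0.\<close>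

lemma geom_op_bounded_linear:
  assumes p: "p > 0" and q: "q < 1" and w: "\<And>n. cmod (w n) \<le> q"
    and g: "\<And>f k N. (\<And>n. f n \<ge> (0::real)) \<Longrightarrow> f 0 = 0 \<Longrightarrow> summable f \<Longrightarrow> (\<Sum>n<N. f (g n k)) \<le> suminf f"
  shows "lp_bounded_linear p (geom_op w g)"
proof -
  define t where "t = sqrt q"
  have q0: "q \<ge> 0" using w[of 0] norm_ge_zero order_trans by blast
  have t: "0 \<le> t" "t < 1" "t\<^sup>2 = q" using q q0 by (auto simp: t_def)
  have tp: "t powr p < 1"
    using powr_less_mono2[of p t 1] t p by simp
  \<comment> \<open>The first factor stems from the pointwise estimate, the second from summing the
    remaining weights \<open>(t powr p) ^ k\<close>.\<close>
  define K where "K = (1 / (1 - t)) powr p * (1 / (1 - t powr p))"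
  have K: "K \<ge> 0" using tp by (simp add: K_def)
  have main: "geom_op w g x \<in> lp p \<and>
      lp_norm p (geom_op w g x) \<le> K powr (1 / p) * lp_norm p x" if x: "x \<in> lp p" for x
  proof -
    define f where "f = (\<lambda>n. cmod (x n) powr p)"
    have f: "summable f" "f 0 = 0" "\<And>n. f n \<ge> 0"
      using x by (auto simp: f_def lp_def)
    have fF: "cmod (x n) powr p \<le> suminf f" for n
      using sum_le_suminf[OF f(1), of "{n}"] f by (auto simp: f_def)
    note G = geometric_series_powr_le[OF p t(1,2) w[folded t(3)], of "\<lambda>k. x (g _ k)" "suminf f",
        OF fF]
    have "(\<Sum>n<N. cmod (geom_op w g x n) powr p) \<le> K * (\<Sum>n. cmod (x n) powr p)" for N
    proof -
      have sm: "summable (\<lambda>k. (t powr p) ^ k * f (g n k))" for n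
        using G(2)[of n] by (simp add: f_def)
      have "cmod (geom_op w g x n) powr p
          \<le> (1 / (1 - t)) powr p * (\<Sum>k. (t powr p) ^ k * f (g n k))" for n
      proof (cases "n = 0")
        case True
        thus ?thesis using f sm by (auto simp: geom_op_def intro!: mult_nonneg_nonneg suminf_nonneg)
      next
        case False
        thus ?thesis using G(1)[of n n] by (simp add: geom_op_def f_def)
      qed
      hence "(\<Sum>n<N. cmod (geom_op w g x n) powr p)
          \<le> (\<Sum>n<N. (1 / (1 - t)) powr p * (\<Sum>k. (t powr p) ^ k * f (g n k)))"
        by (intro sum_mono)
      also have "\<dots> = (1 / (1 - t)) powr p * (\<Sum>k. (t powr p) ^ k * (\<Sum>n<N. f (g n k)))"
        unfolding sum_distrib_left[symmetric] suminf_sum[OF sm, symmetric] ..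
      also have "\<dots> \<le> (1 / (1 - t)) powr p * (\<Sum>k. (t powr p) ^ k * suminf f)"
        using sm tp f
        by (intro mult_left_mono suminf_le g summable_mult2 summable_geometric)
          (auto simp: sum_distrib_left intro!: summable_sum)
      also have "\<dots> = K * suminf f"
        using tp by (simp add: K_def suminf_mult2[symmetric] summable_geometric suminf_geometric)
      finally show ?thesis by (simp add: f_def)
    qed
    thus ?thesis
      using lp_dominated[OF p K, of "geom_op w g x" x] by (auto simp: geom_op_def)
  qed
  have sm: "summable (\<lambda>k. w n ^ k * x (g n k))" if "x \<in> lp p" for x n
    using lp_bounded[OF p that] summable_geom_op[of "w n" "\<lambda>k. x (g n k)"] w q
    by (metis le_less_trans)
  show ?thesis
    unfolding lp_bounded_linear_def
  proof (intro conjI)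
    show "\<exists>C. \<forall>x\<in>lp p. lp_norm p (geom_op w g x) \<le> C * lp_norm p x" using main by blast
    show "\<forall>x\<in>lp p. \<forall>y\<in>lp p. geom_op w g (\<lambda>n. x n + y n) = (\<lambda>n. geom_op w g x n + geom_op w g y n)"
      using sm by (auto simp: geom_op_def fun_eq_iff distrib_left suminf_add)
    show "\<forall>c. \<forall>x\<in>lp p. geom_op w g (\<lambda>n. c * x n) = (\<lambda>n. c * geom_op w g x n)"
      using sm by (auto simp: geom_op_def fun_eq_iff mult.left_commute[of _ c] suminf_mult
          mult.left_commute)
  qed (use main in auto)
qed

lemma geom_op_forward_bounded_linear:
  assumes "p > 0" "q < 1" "\<And>n. cmod (w n) \<le> q"
  shows "lp_bounded_linear p (geom_op w (\<lambda>n k. n + 2 * k))"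
proof (rule geom_op_bounded_linear[OF assms])
  fix f :: "nat \<Rightarrow> real" and k N
  assume f: "\<And>n. f n \<ge> 0" "summable f"
  have "(\<Sum>n<N. f (n + 2 * k)) = sum f ((\<lambda>n. n + 2 * k) ` {..<N})"
    by (subst sum.reindex) (auto simp: inj_on_def)
  also have "\<dots> \<le> suminf f" using f by (intro sum_le_suminf) auto
  finally show "(\<Sum>n<N. f (n + 2 * k)) \<le> suminf f" .
qed

lemma geom_op_backward_bounded_linear:
  assumes "p > 0" "q < 1" "\<And>n. cmod (w n) \<le> q"
  shows "lp_bounded_linear p (geom_op w (\<lambda>n k. n - 2 * k))"
proof (rule geom_op_bounded_linear[OF assms])
  fix f :: "nat \<Rightarrow> real" and k N
  assume f: "\<And>n. f n \<ge> 0" "f 0 = 0" "summable f"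
  \<comment> \<open>All \<open>n < 2 * k\<close> are sent to 0, where \<open>f\<close> vanishes; on
    the other indices the shift is injective.\<close>
  have "(\<Sum>n<N. f (n - 2 * k)) = (\<Sum>n\<in>{2 * k..<N}. f (n - 2 * k))"
    using f by (intro sum.mono_neutral_right) auto
  also have "\<dots> = sum f ((\<lambda>n. n - 2 * k) ` {2 * k..<N})"
    by (subst sum.reindex) (auto simp: inj_on_def)
  also have "\<dots> \<le> suminf f" using f by (intro sum_le_suminf) auto
  finally show "(\<Sum>n<N. f (n - 2 * k)) \<le> suminf f" .
qed

section \<open>The complement of the two intervals\<close>

text \<open>The roots \<open>a\<close> and \<open>b\<close> of \<open>w\<^sup>2 - u * w + 1\<close>
  have product 1, so one of them lies inside the unit circle unless both lie on it. In that case
  \<open>b = cnj a\<close>, so \<open>u = 2 * Re a\<close> lies in \<open>[-2, 2]\<close> and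
  \<open>z\<close> in the interval.\<close>

lemma joukowski_preimage:
  assumes z: "z \<notin> complex_of_real ` {r - 2 * s..r + 2 * s}" and s: "s > 0"
  obtains w where "cmod w < 1" "w \<noteq> 0" "w * (z - of_real r) = of_real s * (w\<^sup>2 + 1)"
proof -
  define u where "u = (z - of_real r) / of_real s"
  define d where "d = csqrt (u\<^sup>2 - 4)"
  define a b where "a = (u + d) / 2" and "b = (u - d) / 2"
  have d: "d\<^sup>2 = u\<^sup>2 - 4" by (simp add: d_def)
  have ab: "a * b = 1"
    using d by (simp add: a_def b_def field_simps power2_eq_square)
  have sum: "a + b = u" by (simp add: a_def b_def field_simps)
  have ne: "a \<noteq> 0" "b \<noteq> 0" using ab by auto
  have zu: "z = of_real r + of_real s * u" using s by (simp add: u_def)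
  have quad: "w * (z - of_real r) = of_real s * (w\<^sup>2 + 1)" if "w = a \<or> w = b" for w
  proof -
    have "w * u = w\<^sup>2 + 1" using that ab sum by (auto simp: power2_eq_square algebra_simps)
    thus ?thesis by (simp add: zu mult.left_commute)
  qed
  have "cmod a \<noteq> 1"
  proof
    assume 1: "cmod a = 1"
    hence "a * cnj a = 1" by (simp add: complex_norm_square[symmetric])
    hence "b = cnj a" using ab ne by (metis mult_left_cancel)
    hence u: "u = of_real (2 * Re a)" using sum complex_add_cnj by metis
    have "\<bar>Re a\<bar> \<le> 1" using abs_Re_le_cmod[of a] 1 by simp
    hence "\<bar>s * Re a\<bar> \<le> s" using s by (simp add: abs_mult)
    hence "r + 2 * (s * Re a) \<in> {r - 2 * s..r + 2 * s}" by (simp add: abs_le_iff)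
    moreover have "z = of_real (r + 2 * (s * Re a))" by (simp add: zu u)
    ultimately show False using z by blast
  qed
  moreover have "cmod a * cmod b = 1" using ab by (metis norm_mult norm_one)
  ultimately have "cmod a < 1 \<or> cmod b < 1"
    by (smt (verit) mult_le_cancel_left1 norm_ge_zero mult_less_cancel_left1)
  thus ?thesis using that ne quad by blast
qed

text \<open>The series applied after the factor, as needed for \<open>B (L x) = x\<close>. The sum
  telescopes because \<open>w ^ k * a k\<close> tends to 0.\<close>

lemma geometric_telescope:
  fixes w :: complex
  assumes "cmod w < 1" "\<And>k. cmod (a k) \<le> M"
  shows "(\<Sum>k. w ^ k * (a k - w * a (Suc k))) = a 0"
proof -
  have "(\<lambda>k. w ^ k * a k) \<longlonglongrightarrow> 0"
    by (rule summable_LIMSEQ_zero[OF summable_geom_op[OF assms]])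
  from telescope_sums'[OF this] show ?thesis
    by (simp add: sums_iff algebra_simps)
qed

text \<open>The opposite order, the factor applied to its series, as needed for
  \<open>L (B y) = y\<close>: \<open>w\<close> times the second series is the tail of the
  first.\<close>

lemma geometric_split_head:
  fixes w :: complex
  assumes "cmod w < 1" "\<And>k. cmod (a k) \<le> M"
  shows "(\<Sum>k. w ^ k * a k) - w * (\<Sum>k. w ^ k * a (Suc k)) = a 0"
proof -
  have "summable (\<lambda>k. w ^ k * a (Suc k))"
    using summable_geom_op[OF assms(1), of "\<lambda>k. a (Suc k)"] assms(2) by blast
  hence "(\<Sum>k. w ^ Suc k * a (Suc k)) = w * (\<Sum>k. w ^ k * a (Suc k))"
    by (simp add: suminf_mult[symmetric] mult.assoc)
  thus ?thesis
    using suminf_split_head[OF summable_geom_op[OF assms], of "\<lambda>k. k"] by simp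
qed

text \<open>
  The spectral parameter is eliminated: \<open>z n\<close> plays the role of $z - r_n$, which varies with the
  parity of \<open>n\<close>. By truncated subtraction all backward terms with \<open>2 * k \<ge> n\<close> equal \<open>x 0 = 0\<close>.
\<close>

lemma two_step_laplacian_inverse:
  fixes w s z :: "nat \<Rightarrow> complex"
  assumes p: "p > 0" and q: "q < 1" and w: "\<And>n. cmod (w n) \<le> q" and w0: "\<And>n. w n \<noteq> 0"
    and c: "\<And>n. cmod (w n / s n) \<le> C" and s0: "\<And>n. s n \<noteq> 0"
    and per: "\<And>n. w (n + 2) = w n" "\<And>n. s (n + 2) = s n"
    and wz: "\<And>n. w n * z n = s n * ((w n)\<^sup>2 + 1)"
  defines "L \<equiv> \<lambda>x n. if n = 0 then 0 else s n * (x (n - 2) + x (n + 2)) - z n * x n"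
  shows "\<exists>B. lp_bounded_linear p B \<and> (\<forall>x\<in>lp p. B (L x) = x) \<and> (\<forall>y\<in>lp p. L (B y) = y)"
proof -
  define U where "U = geom_op w (\<lambda>n k. n + 2 * k)"
  define V where "V = geom_op w (\<lambda>n k. n - 2 * k)"
  \<comment> \<open>The factorisation inverted in reverse order: \<open>U\<close> inverts
    \<open>1 - w S\<^sup>*\<close> and \<open>V\<close> inverts \<open>1 - w S\<close>. The weight
    \<open>- (w n / s n)\<close> is constant along each parity class and commutes with both.\<close>
  define B where "B = (\<lambda>y n. - (w n / s n) * V (U y) n)"
  have U: "lp_bounded_linear p U" and V: "lp_bounded_linear p V"
    unfolding U_def V_def
    by (intro geom_op_forward_bounded_linear[OF p q] geom_op_backward_bounded_linear[OF p q] w)+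
  have w1: "cmod (w n) < 1" for n using w q by (rule le_less_trans)
  have UV_lp: "U x \<in> lp p" "V x \<in> lp p" if "x \<in> lp p" for x
    using U V that by (auto simp: lp_bounded_linear_def)
  have B: "lp_bounded_linear p B"
    unfolding B_def using c
    by (intro lp_bounded_linear_compose[OF lp_bounded_linear_diag[OF p]]
        lp_bounded_linear_compose[OF V U]) auto
  have wm: "w (n - 2) = w n" if "n \<ge> 2" for n
    using per(1)[of "n - 2"] that by (metis le_add_diff_inverse2)
  have sm: "s (n - 2) = s n" if "n \<ge> 2" for n
    using per(2)[of "n - 2"] that by (metis le_add_diff_inverse2)
  have wk: "w (n + 2 * k) = w n" "s (n + 2 * k) = s n" for n k
  proof (induction k)
    case (Suc k)
    { case 1 show ?case using Suc per(1)[of "n + 2 * k"] by (simp add: algebra_simps) }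
    { case 2 show ?case using Suc per(2)[of "n + 2 * k"] by (simp add: algebra_simps) }
  qed auto
  have zs: "z n = s n * (w n + 1 / w n)" for n
    using wz[of n] w0[of n] by (simp add: field_simps power2_eq_square)
  have LB: "L (B y) = y" if y: "y \<in> lp p" for y
  proof
    fix n
    obtain M where M: "\<forall>n. cmod (y n) \<le> M" using lp_bounded[OF p y] by blast
    obtain M' where M': "\<forall>n. cmod (U y n) \<le> M'" using lp_bounded[OF p UV_lp(1)[OF y]] by blast
    have V0: "V (U y) 0 = 0" and U0: "U y 0 = 0" by (simp_all add: U_def V_def geom_op_def)
    show "L (B y) n = y n"
    proof (cases "n = 0")
      case True
      thus ?thesis using y by (simp add: L_def lp_def)
    next
      case n: False
      have U: "U y n - w n * U y (n + 2) = y n"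
        using geometric_split_head[OF w1, of "\<lambda>k. y (n + 2 * k)" M n] M n
        by (simp add: U_def geom_op_def per[simplified] algebra_simps)
      have V: "V (U y) m - w m * V (U y) (m - 2) = U y m" if m: "m \<noteq> 0" for m
      proof -
        have "V (U y) (m - 2) = (\<Sum>k. w m ^ k * U y (m - 2 * Suc k))"
        \<comment> \<open>For \<open>m \<le> 2\<close> truncation yields index 0, of the wrong
          parity if \<open>m = 1\<close>; both sides are then 0 because \<open>V (U y) 0 = 0\<close>
          and \<open>U y 0 = 0\<close>.\<close>
        proof (cases "m \<le> 2")
          case True
          hence "(\<lambda>k. w m ^ k * U y (m - 2 * Suc k)) = (\<lambda>k. 0)" by (simp add: U0 fun_eq_iff)
          thus ?thesis using True by (simp add: V0)
        next
          case False
          thus ?thesis using wm[of m] by (simp add: V_def geom_op_def diff_diff_eq)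
        qed
        thus ?thesis
          using geometric_split_head[OF w1, of "\<lambda>k. U y (m - 2 * k)" M' m] M' m
          by (simp add: V_def geom_op_def)
      qed
      \<comment> \<open>For \<open>n = 1\<close> the truncated index 0 has the other parity; the
        change of weight does no harm as \<open>V (U y) 0 = 0\<close>.\<close>
      have Bm: "B y (n - 2) = - (w n / s n) * V (U y) (n - 2)"
      proof (cases "n \<ge> 2")
        case True
        thus ?thesis by (simp add: B_def wm sm)
      next
        case False
        thus ?thesis by (simp add: B_def V0)
      qed
      have Bp: "B y (n + 2) = - (w n / s n) * V (U y) (n + 2)"
        by (simp add: B_def per[simplified])
      have "L (B y) n = - w n * (V (U y) (n - 2) + V (U y) (n + 2)) + ((w n)\<^sup>2 + 1) * V (U y) n"
        using n s0[of n] w0[of n] unfolding L_def Bm Bp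
        by (simp add: B_def zs field_simps power2_eq_square)
      \<comment> \<open>Regrouped as \<open>1 - w S\<^sup>*\<close> applied to
        \<open>V (U y) n - w n * V (U y) (n - 2)\<close>, which equals \<open>U y n\<close>.\<close>
      also have "\<dots> = (V (U y) n - w n * V (U y) (n - 2)) - w n * (V (U y) (n + 2) - w n * V (U y) n)"
        by (simp add: algebra_simps power2_eq_square)
      also have "\<dots> = y n"
        using V[OF n] V[of "n + 2"] U by (simp add: per[simplified])
      finally show ?thesis .
    qed
  qed
  have BL: "B (L x) = x" if x: "x \<in> lp p" for x
  proof
    fix n
    have x0: "x 0 = 0" using x by (simp add: lp_def)
    obtain M where M: "\<forall>n. cmod (x n) \<le> M" using lp_bounded[OF p x] by blast
    \<comment> \<open>This is \<open>1 - w S\<close> applied to \<open>x\<close>. Up to the weight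
      \<open>- (s n / w n)\<close>, \<open>L x\<close> is \<open>1 - w S\<^sup>*\<close> applied to
      \<open>h\<close>, so \<open>U\<close> recovers \<open>h\<close> and \<open>V\<close> then
      recovers \<open>x\<close>.\<close>
    define h where "h = (\<lambda>n. x n - w n * x (n - 2))"
    have hM: "cmod (h n) \<le> M + M" for n
    proof -
      have "cmod (h n) \<le> cmod (x n) + cmod (w n) * cmod (x (n - 2))"
        unfolding h_def by (metis norm_triangle_ineq4 norm_mult)
      also have "\<dots> \<le> M + 1 * M"
        using M w1 less_imp_le by (intro add_mono mult_mono) auto
      finally show ?thesis by simp
    qed
    have Lh: "L x n = - (s n / w n) * (h n - w n * h (n + 2))" if "n \<noteq> 0" for n
      using that s0[of n] w0[of n]
      by (simp add: L_def h_def per[simplified] zs field_simps power2_eq_square)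
    have U: "U (L x) n = - (s n / w n) * h n" for n
    proof (cases "n = 0")
      case True
      thus ?thesis by (simp add: U_def geom_op_def h_def x0)
    next
      case False
      have Lk: "L x (n + 2 * k) = - (s n / w n) * (h (n + 2 * k) - w n * h (n + 2 * Suc k))" for k
        using False Lh[of "n + 2 * k"] by (simp add: wk)
      have "U (L x) n = (\<Sum>k. - (s n / w n) * (w n ^ k * (h (n + 2 * k) - w n * h (n + 2 * Suc k))))"
        using False Lk by (simp add: U_def geom_op_def mult.left_commute)
      also have "\<dots> = - (s n / w n) * (\<Sum>k. w n ^ k * (h (n + 2 * k) - w n * h (n + 2 * Suc k)))"
      proof (rule suminf_mult)
        have "cmod (h (n + 2 * k) - w n * h (n + 2 * Suc k)) \<le> (M + M) + 1 * (M + M)" for k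
          by (rule order_trans[OF norm_triangle_ineq4], unfold norm_mult)
            (use hM w1 less_imp_le in \<open>intro add_mono mult_mono; auto\<close>)
        thus "summable (\<lambda>k. w n ^ k * (h (n + 2 * k) - w n * h (n + 2 * Suc k)))"
          by (rule summable_geom_op[OF w1])
      qed
      also have "(\<Sum>k. w n ^ k * (h (n + 2 * k) - w n * h (n + 2 * Suc k))) = h n"
        using geometric_telescope[OF w1, of "\<lambda>k. h (n + 2 * k)" "M + M" n] hM by simp
      finally show ?thesis .
    qed
    show "B (L x) n = x n"
    proof (cases "n = 0")
      case True
      thus ?thesis by (simp add: B_def V_def geom_op_def x0)
    next
      case False
      \<comment> \<open>For \<open>2 * k > n\<close> all truncated indices are 0 and both sides
        vanish, so a mismatch of parity is harmless.\<close>
      have *: "U (L x) (n - 2 * k) = - (s n / w n) * (x (n - 2 * k) - w n * x (n - 2 * Suc k))" for k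
      proof (cases "2 * k \<le> n")
        case True
        thus ?thesis using wk[of "n - 2 * k" k] by (simp add: U h_def)
      next
        case False
        thus ?thesis by (simp add: U h_def x0)
      qed
      have "V (U (L x)) n
          = (\<Sum>k. - (s n / w n) * (w n ^ k * (x (n - 2 * k) - w n * x (n - 2 * Suc k))))"
        using False unfolding V_def geom_op_def * by (simp add: mult.left_commute)
      also have "\<dots> = - (s n / w n) * (\<Sum>k. w n ^ k * (x (n - 2 * k) - w n * x (n - 2 * Suc k)))"
      proof (rule suminf_mult)
        have "cmod (x (n - 2 * k) - w n * x (n - 2 * Suc k)) \<le> M + 1 * M" for k
          by (rule order_trans[OF norm_triangle_ineq4], unfold norm_mult)
            (use M w1 less_imp_le in \<open>intro add_mono mult_mono; auto\<close>)
        thus "summable (\<lambda>k. w n ^ k * (x (n - 2 * k) - w n * x (n - 2 * Suc k)))"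
          by (rule summable_geom_op[OF w1])
      qed
      also have "(\<Sum>k. w n ^ k * (x (n - 2 * k) - w n * x (n - 2 * Suc k))) = x n"
        using geometric_telescope[OF w1, of "\<lambda>k. x (n - 2 * k)" M n] M by simp
      finally show ?thesis using s0[of n] w0[of n] by (simp add: B_def)
    qed
  qed
  show ?thesis using B LB BL by blast
qed

lemma T0_resolvent:
  assumes p: "p > 0" and s: "s1 > 0" "s2 > 0"
    and z1: "z \<notin> complex_of_real ` {r1 - 2 * s1..r1 + 2 * s1}"
    and z2: "z \<notin> complex_of_real ` {r2 - 2 * s2..r2 + 2 * s2}"
  shows "z \<notin> lp_spectrum p (T0 r1 r2 s1 s2)"
proof -
  obtain w1 where w1: "cmod w1 < 1" "w1 \<noteq> 0" "w1 * (z - of_real r1) = of_real s1 * (w1\<^sup>2 + 1)"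
    using joukowski_preimage[OF z1 s(1)] .
  obtain w2 where w2: "cmod w2 < 1" "w2 \<noteq> 0" "w2 * (z - of_real r2) = of_real s2 * (w2\<^sup>2 + 1)"
    using joukowski_preimage[OF z2 s(2)] .
  \<comment> \<open>The data of the two parity classes are glued to 2-periodic coefficients;
    \<open>r n\<close> takes the place of \<open>z n\<close> in
    \<open>two_step_laplacian_inverse\<close>.\<close>
  define w where "w = (\<lambda>n::nat. if odd n then w1 else w2)"
  define s where "s = (\<lambda>n::nat. complex_of_real (if odd n then s1 else s2))"
  define r where "r = (\<lambda>n::nat. z - complex_of_real (if odd n then r1 else r2))"
  define L where "L = (\<lambda>x n. if n = 0 then 0 else s n * (x (n - 2) + x (n + 2)) - r n * x n)"
  have "\<exists>B. lp_bounded_linear p B \<and> (\<forall>x\<in>lp p. B (L x) = x) \<and> (\<forall>y\<in>lp p. L (B y) = y)"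
    unfolding L_def
    by (rule two_step_laplacian_inverse[where w = w and q = "max (cmod w1) (cmod w2)"
          and C = "max (cmod (w1 / of_real s1)) (cmod (w2 / of_real s2))"])
      (use p \<open>s1 > 0\<close> \<open>s2 > 0\<close> w1 w2 in \<open>auto simp: w_def s_def r_def\<close>)
  then obtain B where B: "lp_bounded_linear p B" "\<And>x. x \<in> lp p \<Longrightarrow> B (L x) = x"
      "\<And>y. y \<in> lp p \<Longrightarrow> L (B y) = y"
    by blast
  \<comment> \<open>At index 0 the left side is \<open>- z * x 0\<close>, which is 0 only because
    \<open>x\<close> lies in the carrier.\<close>
  have L: "(\<lambda>n. T0 r1 r2 s1 s2 x n - z * x n) = L x" if "x \<in> lp p" for x
    using that by (auto simp: T0_def L_def s_def r_def lp_def fun_eq_iff algebra_simps)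
  have "B y \<in> lp p" if "y \<in> lp p" for y
    using B(1) that by (simp add: lp_bounded_linear_def)
  thus ?thesis
    unfolding lp_spectrum_def using B L by auto
qed

section \<open>The two intervals\<close>

text \<open>At \<open>c = 1\<close> and \<open>c = -1\<close> the conserved form is a perfect square
  and not definite, so its vanishing does not give \<open>a = 0\<close> directly. It does give
  consecutive terms of equal absolute value, and a constant absolute value with limit 0 is
  0.\<close>

lemma bounded_oscillation_zero:
  fixes a :: "nat \<Rightarrow> real"
  assumes rec: "\<And>n. a (n + 2) = 2 * c * a (n + 1) - a n" and c: "\<bar>c\<bar> \<le> 1" and lim: "a \<longlonglongrightarrow> 0"
  shows "a n = 0"
proof -
  define E where "E = (\<lambda>n. (a (n + 1))\<^sup>2 + (a n)\<^sup>2 - 2 * c * a n * a (n + 1))"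
  have "E (Suc n) = E n" for n
    using rec[of n] by (simp add: E_def) (simp add: power2_eq_square algebra_simps)
  hence E: "E n = E 0" for n by (induction n) auto
  have "E \<longlonglongrightarrow> 0\<^sup>2 + 0\<^sup>2 - 2 * c * 0 * 0"
    unfolding E_def using LIMSEQ_ignore_initial_segment[OF lim, of 1] lim by (intro tendsto_intros)
  moreover have "E \<longlonglongrightarrow> E 0" using E by (simp add: tendsto_eventually)
  ultimately have "E 0 = 0" using LIMSEQ_unique by fastforce
  have abs: "\<bar>a (Suc n)\<bar> = \<bar>a n\<bar>" for n
  proof -
    \<comment> \<open>Since \<open>\<bar>c\<bar> \<le> 1\<close>, the mixed term of \<open>E\<close>
      is at most \<open>2 * \<bar>a n\<bar> * \<bar>a (n + 1)\<bar>\<close>, so \<open>E\<close>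
      dominates the square of the difference of absolute values.\<close>
    have "c * (a n * a (n + 1)) \<le> \<bar>c\<bar> * \<bar>a n * a (n + 1)\<bar>"
      by (metis abs_ge_self abs_mult)
    also have "\<dots> \<le> 1 * \<bar>a n * a (n + 1)\<bar>"
      by (intro mult_right_mono c) auto
    finally have "c * (a n * a (n + 1)) \<le> \<bar>a n\<bar> * \<bar>a (n + 1)\<bar>"
      by (simp add: abs_mult)
    hence "(\<bar>a (n + 1)\<bar> - \<bar>a n\<bar>)\<^sup>2 \<le> E n"
      by (simp add: E_def power2_diff abs_mult algebra_simps)
    hence "(\<bar>a (n + 1)\<bar> - \<bar>a n\<bar>)\<^sup>2 \<le> 0" using E \<open>E 0 = 0\<close> by simp
    thus ?thesis by simp
  qed
  have "\<bar>a n\<bar> = \<bar>a 0\<bar>" for n by (induction n) (use abs in auto)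
  hence "(\<lambda>n. \<bar>a n\<bar>) \<longlonglongrightarrow> \<bar>a 0\<bar>" and "\<bar>a n\<bar> = \<bar>a 0\<bar>" by (auto simp: tendsto_eventually)
  thus ?thesis using tendsto_rabs_zero[OF lim] LIMSEQ_unique by fastforce
qed

lemma unit_vector_lp:
  assumes "i \<noteq> 0"
  shows "(\<lambda>n. if n = i then 1 else 0) \<in> lp p"
  using assms by (auto simp: lp_def intro!: summable_finite[of "{i}"] split: if_splits)

text \<open>The disjunction treats both parity classes together, \<open>i\<close> being the first
  index of the class. Surjectivity fails at the unit vector at \<open>i\<close>.\<close>

lemma T0_spectrum_interval:
  fixes i :: nat
  assumes p: "p > 0" and s: "s > 0"
    and i: "i = 1 \<and> s = s1 \<and> r = r1 \<or> i = 2 \<and> s = s2 \<and> r = r2"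
    and t: "t \<in> {r - 2 * s..r + 2 * s}"
  shows "complex_of_real t \<in> lp_spectrum p (T0 r1 r2 s1 s2)"
proof -
  define e :: "nat \<Rightarrow> complex" where "e = (\<lambda>n. if n = i then 1 else 0)"
  have "e \<in> lp p" unfolding e_def using i by (intro unit_vector_lp) auto
  have False if x: "x \<in> lp p" and eq: "(\<lambda>n. T0 r1 r2 s1 s2 x n - of_real t * x n) = e" for x
  proof -
    define a where "a = (\<lambda>k. x (i + 2 * k))"
    define c where "c = (t - r) / (2 * s)"
    have tc: "t = r + 2 * s * c" using s by (simp add: c_def)
    have c: "\<bar>c\<bar> \<le> 1" using t s by (auto simp: c_def abs_le_iff field_simps)
    have x0: "x 0 = 0" using x by (simp add: lp_def)
    have eqn: "T0 r1 r2 s1 s2 x n - of_real t * x n = e n" for n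
      using eq by (rule fun_cong)
    \<comment> \<open>The indices \<open>i + 2 * (n + 1)\<close> avoid \<open>i\<close>, so
      \<open>e\<close> vanishes there. The equation at \<open>i\<close> itself is kept for the
      contradiction.\<close>
    have rec: "a (n + 2) = of_real (2 * c) * a (n + 1) - a n" for n
    proof -
      have "of_real s * a n + of_real r * a (n + 1) + of_real s * a (n + 2)
          - of_real t * a (n + 1) = 0"
        using eqn[of "i + 2 * (n + 1)"] i by (auto simp: T0_def e_def a_def algebra_simps)
      hence "of_real s * (a (n + 2) - (of_real (2 * c) * a (n + 1) - a n)) = 0"
        by (simp add: tc algebra_simps)
      thus ?thesis using s by simp
    qed
    have "a \<longlonglongrightarrow> 0"
      using LIMSEQ_subseq_LIMSEQ[OF lp_tendsto_0[OF p x], of "\<lambda>k. i + 2 * k"]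
      by (simp add: a_def strict_mono_def o_def)
    hence lim: "(\<lambda>n. Re (a n)) \<longlonglongrightarrow> 0" "(\<lambda>n. Im (a n)) \<longlonglongrightarrow> 0"
      using tendsto_Re[of a 0] tendsto_Im[of a 0] by simp_all
    \<comment> \<open>The recurrence has real coefficients, so real and imaginary parts satisfy it
      separately.\<close>
    have "Re (a n) = 0" "Im (a n) = 0" for n
      by (rule bounded_oscillation_zero[where c = c], use rec c lim in auto)+
    hence "a n = 0" for n by (simp add: complex_eq_iff)
    from this[of 0] this[of 1] have "x i = 0" "x (i + 2) = 0" by (simp_all add: a_def)
    \<comment> \<open>As \<open>i - 2\<close> truncates to 0, the equation at \<open>i\<close>
      involves only \<open>x 0\<close>, \<open>x i\<close> and \<open>x (i + 2)\<close>; its left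
      side is 0 while \<open>e i = 1\<close>.\<close>
    thus False using eqn[of i] i x0 by (auto simp: T0_def e_def)
  qed
  \<comment> \<open>For an inverse \<open>B\<close>, the sequence \<open>B e\<close> would be such
    an \<open>x\<close>.\<close>
  thus ?thesis
    using \<open>e \<in> lp p\<close> unfolding lp_spectrum_def lp_bounded_linear_def by blast
qed

theorem theorem3p6:
  fixes p r1 r2 s1 s2 :: real
  assumes "1 < p"
    and "r1 \<ge> 0" and "r2 \<ge> 0"
    and "s1 > 0" and "s2 > 0"
  shows "lp_spectrum p (T0 r1 r2 s1 s2) =
    complex_of_real ` {r1 - 2 * s1..r1 + 2 * s1} \<union>
    complex_of_real ` {r2 - 2 * s2..r2 + 2 * s2}"
proof -
  have "p > 0" using assms by simp
  thus ?thesis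
    using T0_resolvent[of p s1 s2 _ r1 r2] assms
      T0_spectrum_interval[of p s1 1 s1 r1 r1 s2 r2] T0_spectrum_interval[of p s2 2 s1 r2 r1 s2 r2]
    by blast
qed

end
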